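(* Let $\mathcal{Q}$ be a nonempty finite set of positive integers with largest element $q$, let $a=|\mathbb{N}_q-\mathcal{Q}|$, and let $p_1<p_2<\cdots<p_a$ be the elements of $\mathbb{N}_q-\mathcal{Q}$. Let $\theta$ be the bit string representation of $\mathcal{Q}$ whereby the $j$-th bit from the right of $\theta$ is $1$ if and only if $j\in\mathcal{Q}$ (so the rightmost bit corresponds to $j=1$). Let $\lfloor\theta/2^b\rfloor$ denote the result of discarding the rightmost $b$ bits of $\theta$ and shifting the remaining bits to the right $b$ places, and let $\mid$ denote the bitwise OR operation. Suppose that $a\ge2$, that $p_a=q-r$ (which implies that $r\ge1$), and that for each $i=1,\ldots,a-1$ the bit string $\theta\mid\lfloor\theta/2^{p_i}\rfloor$ is all ones after discarding the leading zeros. If (a) $q=2r+1$ or (b) $q>2r+1$ and $1\le p_{a-1}\le r$, then for all integers $n$ and $k$, $$\begin{aligned}B_{n,k}&=\delta_{n,0}\delta_{k,0}-\delta_{n,q-r}\delta_{k,1}+B_{n-1,k}+B_{n-q+r,k-1}-B_{n-q+r-1,k-1}+B_{n-q-1,k-1}\\&\qquad+\sum_{i=1}^{a-1}\left(B_{n-q-1-p_i,k-2}-B_{n-2q+r-1-p_i,k-3}\right).\end{aligned}$$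
   Context: $\mathbb{N}_q=\{1,2,\ldots,q\}$; $\delta_{i,j}$ is $1$ if $i=j$ and $0$ otherwise. An $N$-board is a linear array of $N$ unit square cells, numbered $1,\ldots,N$ from left to right. A square is a $1\times1$ tile. The comb corresponding to $\mathcal{Q}$ (where $q=\max\mathcal{Q}$) is a tile of length $q+1$ with cells numbered $0,1,\ldots,q$ from left to right, in which cell $0$ is filled and cell $i$ ($1\le i\le q$) is filled if and only if $i\in\mathcal{Q}$; unfilled cells are gaps and are not part of the tile. A restricted-overlap tiling of a board is a placement of tiles on the board (each tile lying entirely within the board) such that every cell of the board is covered by a filled cell of at least one tile, and the leftmost cell of each tile is not covered by any other tile; filled cells that are not the leftmost cells of their tiles are allowed to overlap one another. A tiling is determined by which tiles are placed at which positions. $B_{n,k}$ is the number of restricted-overlap tilings of an $n$-board using squares and exactly $k$ combs corresponding to $\mathcal{Q}$. By convention $B_{0,0}=1$ and $B_{n,k}=0$ if $n<0$, $k<0$ or $n<k$. *)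

theory Defs
  imports Complex_Main
begin

datatype tile = Square | Comb

text \<open>
  Cells of a tile are numbered from 0, its leftmost cell.  Throughout, \<open>Q\<close> is a nonempty
  finite set of positive integers.
\<close>

fun tile_length :: "nat set \<Rightarrow> tile \<Rightarrow> nat" where
  "tile_length Q Square = 1"
| "tile_length Q Comb = Max Q + 1"

fun filled_cells :: "nat set \<Rightarrow> tile \<Rightarrow> nat set" where
  "filled_cells Q Square = {0}"
| "filled_cells Q Comb = insert 0 Q"

text \<open>
  A placed tile is a pair \<open>(c, t)\<close>, where \<open>c\<close> is the board cell occupied by cell 0 of \<open>t\<close>.
\<close>

definition covers :: "nat set \<Rightarrow> nat \<times> tile \<Rightarrow> nat set" where
  "covers Q x = (\<lambda>i. fst x + i) ` filled_cells Q (snd x)"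

text \<open>
  Sets of placed tiles suffice (no multiplicities): two copies of a tile at the same
  position would cover each other's leftmost cell.
\<close>

definition restricted_overlap_tiling :: "nat set \<Rightarrow> nat \<Rightarrow> (nat \<times> tile) set \<Rightarrow> bool" where
  "restricted_overlap_tiling Q N T \<longleftrightarrow>
     (\<forall>(c, t) \<in> T. {c..<c + tile_length Q t} \<subseteq> {1..N}) \<and>
     (\<forall>m \<in> {1..N}. \<exists>x \<in> T. m \<in> covers Q x) \<and>
     (\<forall>x \<in> T. \<forall>y \<in> T. x \<noteq> y \<longrightarrow> fst x \<notin> covers Q y)"

definition comb_tilings :: "nat set \<Rightarrow> nat \<Rightarrow> nat \<Rightarrow> (nat \<times> tile) set set" where
  "comb_tilings Q N k =
     {T. restricted_overlap_tiling Q N T \<and> card {x \<in> T. snd x = Comb} = k}"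

definition B :: "nat set \<Rightarrow> int \<Rightarrow> int \<Rightarrow> int" where
  "B Q n k = (if n < 0 \<or> k < 0 then 0 else int (card (comb_tilings Q (nat n) (nat k))))"

text \<open>
  The remaining conventions, \<open>B Q 0 0 = 1\<close> and \<open>B Q n k = 0\<close> for \<open>n < k\<close>, are consequences.
\<close>

lemma tiling_subset:
  assumes "restricted_overlap_tiling Q N T"
  shows "T \<subseteq> {1..N} \<times> {Square, Comb}"
proof
  fix x assume "x \<in> T"
  moreover obtain c t where x: "x = (c, t)" by fastforce
  ultimately have "{c..<c + tile_length Q t} \<subseteq> {1..N}"
    using assms by (auto simp: restricted_overlap_tiling_def)
  moreover have "c \<in> {c..<c + tile_length Q t}" by (cases t) auto
  ultimately have "c \<in> {1..N}" by blast
  then show "x \<in> {1..N} \<times> {Square, Comb}" using x by (cases t) auto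
qed

lemma finite_comb_tilings: "finite (comb_tilings Q N k)"
  by (rule finite_subset[of _ "Pow ({1..N} \<times> {Square, Comb})"])
     (use tiling_subset in \<open>fastforce simp: comb_tilings_def\<close>, simp)

lemma B_0_0: "B Q 0 0 = 1"
proof -
  have "restricted_overlap_tiling Q 0 T \<longleftrightarrow> T = {}" for T
    using tiling_subset[of Q 0 T] by (auto simp: restricted_overlap_tiling_def)
  then have "T \<in> comb_tilings Q 0 0 \<longleftrightarrow> T = {} \<and> card {x \<in> T. snd x = Comb} = 0" for T
    unfolding comb_tilings_def by blast
  moreover have "card {x \<in> ({} :: (nat \<times> tile) set). snd x = Comb} = 0" by simp
  ultimately have "comb_tilings Q 0 0 = {{}}" by blast
  then show ?thesis by (simp add: B_def)
qed

lemma B_eq_0: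
  assumes "n < k"
  shows "B Q n k = 0"
proof (cases "n < 0")
  case False
  have "T \<notin> comb_tilings Q (nat n) (nat k)" for T
  proof
    assume T: "T \<in> comb_tilings Q (nat n) (nat k)"
    then have "{x \<in> T. snd x = Comb} \<subseteq> {1..nat n} \<times> {Comb}"
      using tiling_subset[of Q "nat n" T] by (auto simp: comb_tilings_def)
    then have "card {x \<in> T. snd x = Comb} \<le> card ({1..nat n} \<times> {Comb})"
      by (intro card_mono) auto
    then show False using T assms False by (simp add: comb_tilings_def)
  qed
  then have "comb_tilings Q (nat n) (nat k) = {}" by blast
  then show ?thesis by (simp add: B_def)
qed (simp add: B_def)

text \<open>
  Bit strings are represented by the natural numbers they denote in binary; the \<open>j\<close>-th bit
  from the right is \<open>bit _ (j - 1)\<close>.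
\<close>

definition bit_string :: "nat set \<Rightarrow> nat" where
  "bit_string Q = (\<Sum>j\<in>Q. 2 ^ (j - 1))"

lemma bit_bit_string:
  assumes "finite Q" "0 \<notin> Q" "j \<ge> 1"
  shows "bit (bit_string Q) (j - 1) \<longleftrightarrow> j \<in> Q"
  using assms
proof (induction Q arbitrary: j rule: finite_induct)
  case (insert x F)
  have IH: "bit (bit_string F) (i - 1) \<longleftrightarrow> i \<in> F" if "i \<ge> 1" for i
    using insert.IH insert.prems(1,2) that by blast
  have "x \<ge> 1" using insert.prems(1) by (cases x) auto
  then have disj: "and (2 ^ (x - 1)) (bit_string F) = 0"
    using IH[of x] insert.hyps(2) by (intro bit_eqI) (auto simp: bit_and_iff bit_exp_iff)
  have "bit_string (insert x F) = 2 ^ (x - 1) + bit_string F"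
    using insert.hyps by (simp add: bit_string_def)
  also have "\<dots> = or (2 ^ (x - 1)) (bit_string F)"
    using disj by (rule disjunctive_add_eq_or)
  finally show ?case
    using IH[OF insert.prems(2)] insert.prems(2) \<open>x \<ge> 1\<close>
    by (metis bit_or_iff bit_exp_iff possible_bit_nat insert_iff eq_diff_iff)
qed (simp add: bit_string_def)

text \<open>\<open>mask m\<close> is the string of \<open>m\<close> ones.\<close>

definition all_ones :: "nat \<Rightarrow> bool" where
  "all_ones x \<longleftrightarrow> (\<exists>m. x = mask m)"

end

theory Submission
  imports Defs
begin

text \<open>
  The squares of a tiling are exactly the cells missed by the combs, so tilings correspond to
  sets of comb positions in which no two elements differ by an element of \<open>Q\<close>.  The bit
  condition says that \<open>p\<^sub>i + p\<^sub>l \<in> Q\<close> for all \<open>i < a\<close> and all \<open>l\<close>, while \<open>2 * p\<^sub>a > q\<close>.  Hence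
  among the consecutive differences of such a set a difference \<open>p\<^sub>i\<close> with \<open>i < a\<close> is never
  adjacent to another difference \<open>\<le> q\<close>, whereas runs of \<open>p\<^sub>a\<close> are unrestricted.  Let \<open>C n k\<close>
  count the sets with a comb in cell 1 and \<open>D n k\<close> those among them in which the first difference
  is not \<open>p\<^sub>i\<close> for any \<open>i < a\<close>.  Then
  \<open>B n k = \<delta> + B (n - 1) k + C n k\<close>,
  \<open>C n k = D n k + (\<Sum>i<a. B (n - q - 1 - p\<^sub>i) (k - 2))\<close> and
  \<open>D n k = B (n - q - 1) (k - 1) + D (n - p\<^sub>a) (k - 1)\<close>;
  eliminating \<open>C\<close> and \<open>D\<close> gives the recurrence.
\<close>

section \<open>Sets of integers with forbidden differences\<close>

text \<open>Integer endpoints and sizes keep differences and translations free of truncation; an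
  empty window still admits the empty set, and a negative \<open>k\<close> gives the empty
  family.\<close>

definition avoiding :: "int set \<Rightarrow> int \<Rightarrow> int \<Rightarrow> int \<Rightarrow> int set set" where
  "avoiding G l u k =
     {S. S \<subseteq> {l..u} \<and> (\<forall>s\<in>S. \<forall>t\<in>S. t - s \<notin> G) \<and> int (card S) = k}"

lemma finite_avoiding [simp]: "finite (avoiding G l u k)"
  by (rule finite_subset[of _ "Pow {l..u}"]) (auto simp: avoiding_def)

lemma finite_avoiding_mem: "S \<in> avoiding G l u k \<Longrightarrow> finite S"
  by (auto simp: avoiding_def intro: finite_subset)

lemma card_union_image:
  assumes "\<And>S. S \<in> F \<Longrightarrow> S \<inter> X = {}"
  shows "card ((\<union>) X ` F) = card F"
  by (rule card_image, rule inj_onI) (use assms in blast)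

text \<open>Membership depends only on differences; hence a count on any window can be read as a
  value of \<open>B\<close>.\<close>

lemma avoiding_shift: "card (avoiding G (l + d) (u + d) k) = card (avoiding G l u k)"
proof -
  have "avoiding G (l + d) (u + d) k = (\<lambda>S. (+) d ` S) ` avoiding G l u k" (is "?L = ?R")
  proof (intro equalityI subsetI)
    fix S assume S: "S \<in> ?L"
    have inj: "inj_on ((+) (- d)) S" by simp
    have "(+) (- d) ` S \<in> avoiding G l u k"
      using S by (auto simp: avoiding_def card_image[OF inj] simp del: uminus_add_conv_diff)
    moreover have "S = (+) d ` (+) (- d) ` S" by (simp add: image_image)
    ultimately show "S \<in> ?R" by blast
  next
    fix S assume "S \<in> ?R"
    then show "S \<in> ?L" by (auto simp: avoiding_def card_image)
  qed
  moreover have "inj_on (\<lambda>S. (+) d ` S) (avoiding G l u k)"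
    by (rule inj_onI) (simp add: inj_image_eq_iff)
  ultimately show ?thesis by (simp add: card_image)
qed

section \<open>Tilings as sets of comb positions\<close>

lemma covers_Comb: "m \<in> covers Q (c, Comb) \<longleftrightarrow> m = c \<or> (\<exists>j\<in>Q. m = c + j)"
  and covers_Square: "m \<in> covers Q (c, Square) \<longleftrightarrow> m = c"
  by (auto simp: covers_def)

definition tiling_of :: "nat set \<Rightarrow> nat \<Rightarrow> nat set \<Rightarrow> (nat \<times> tile) set" where
  "tiling_of Q N S = (\<lambda>c. (c, Comb)) ` S \<union>
     (\<lambda>c. (c, Square)) ` {c \<in> {1..N}. \<forall>s\<in>S. c \<notin> covers Q (s, Comb)}"

text \<open>A cell missed by all combs needs a square, and the cell of a square is its leftmost
  cell, which no comb may cover.\<close>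

lemma tiling_eq_tiling_of:
  assumes "restricted_overlap_tiling Q N T"
  shows "T = tiling_of Q N {c. (c, Comb) \<in> T}"
proof (intro set_eqI, clarify)
  fix c t
  have sub: "\<And>c t. (c, t) \<in> T \<Longrightarrow> c \<in> {1..N}" using tiling_subset[OF assms] by auto
  have cov: "\<exists>x\<in>T. m \<in> covers Q x" if "m \<in> {1..N}" for m
    using assms that by (auto simp: restricted_overlap_tiling_def)
  have disj: "fst x \<notin> covers Q y" if "x \<in> T" "y \<in> T" "x \<noteq> y" for x y
    using assms that by (auto simp: restricted_overlap_tiling_def)
  show "(c, t) \<in> T \<longleftrightarrow> (c, t) \<in> tiling_of Q N {c. (c, Comb) \<in> T}"
  proof (cases t)
    case Comb
    then show ?thesis by (auto simp: tiling_of_def)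
  next
    case Square
    have "(c, Square) \<in> T" if c: "c \<in> {1..N}" "\<forall>s. (s, Comb) \<in> T \<longrightarrow> c \<notin> covers Q (s, Comb)"
    proof -
      obtain x where x: "x \<in> T" "c \<in> covers Q x" using cov[OF c(1)] by blast
      obtain s t where st: "x = (s, t)" by fastforce
      with x c(2) have "t = Square" by (cases t) auto
      with x st show ?thesis by (simp add: covers_Square)
    qed
    moreover have "c \<notin> covers Q (s, Comb)" if "(c, Square) \<in> T" "(s, Comb) \<in> T" for s
      using disj[OF that] by simp
    ultimately show ?thesis using Square sub by (auto simp: tiling_of_def)
  qed
qed

text \<open>Filling the missed cells with squares settles coverage and every conflict involving
  squares. It remains that combs fit and that none starts on a filled cell of another.\<close>

lemma tiling_of_iff:
  assumes "finite Q" "\<forall>j\<in>Q. j > 0" "Q \<noteq> {}"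
  shows "restricted_overlap_tiling Q N (tiling_of Q N S) \<longleftrightarrow>
    (\<forall>c\<in>S. 1 \<le> c \<and> c + Max Q \<le> N) \<and> (\<forall>s\<in>S. \<forall>t\<in>S. \<forall>j\<in>Q. t \<noteq> s + j)"
  (is "?L \<longleftrightarrow> ?R")
proof
  assume L: ?L
  have comb: "(c, Comb) \<in> tiling_of Q N S" if "c \<in> S" for c using that by (auto simp: tiling_of_def)
  have len: "{c..<c + tile_length Q t} \<subseteq> {1..N}" if "(c, t) \<in> tiling_of Q N S" for c t
    using L that by (auto simp: restricted_overlap_tiling_def)
  have disj: "fst x \<notin> covers Q y" if "x \<in> tiling_of Q N S" "y \<in> tiling_of Q N S" "x \<noteq> y" for x y
    using L that by (auto simp: restricted_overlap_tiling_def)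
  have "1 \<le> c \<and> c + Max Q \<le> N" if "c \<in> S" for c
    using len[OF comb[OF that]] by (simp add: subset_iff)
  \<comment> \<open>Since \<open>j > 0\<close>, an equality \<open>t = s + j\<close> would make the
    two combs distinct, as \<open>disj\<close> requires.\<close>
  moreover have "t \<noteq> s + j" if "s \<in> S" "t \<in> S" "j \<in> Q" for s t j
    using disj[OF comb[OF that(2)] comb[OF that(1)]] assms(2) that by (auto simp: covers_Comb)
  ultimately show ?R by blast
next
  assume R: ?R
  have "{c..<c + tile_length Q t} \<subseteq> {1..N}" if "(c, t) \<in> tiling_of Q N S" for c t
    using R that by (cases t) (fastforce simp: tiling_of_def)+
  moreover have "\<exists>x\<in>tiling_of Q N S. m \<in> covers Q x" if "m \<in> {1..N}" for m
  proof (cases "\<exists>s\<in>S. m \<in> covers Q (s, Comb)")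
    case True
    then show ?thesis by (auto simp: tiling_of_def)
  next
    case False
    with that have "(m, Square) \<in> tiling_of Q N S" by (auto simp: tiling_of_def)
    then show ?thesis by (metis covers_Square)
  qed
  moreover have "fst x \<notin> covers Q y"
    if "x \<in> tiling_of Q N S" "y \<in> tiling_of Q N S" "x \<noteq> y" for x y
    using R that by (auto simp: tiling_of_def covers_Comb covers_Square)
  ultimately show ?L unfolding restricted_overlap_tiling_def by blast
qed

lemma combs_of_tiling_of: "{c. (c, Comb) \<in> tiling_of Q N S} = S"
  by (auto simp: tiling_of_def)

lemma card_combs: "card {x \<in> T. snd x = Comb} = card {c. (c, Comb) \<in> T}"
proof -
  have "{x \<in> T. snd x = Comb} = (\<lambda>c. (c, Comb)) ` {c. (c, Comb) \<in> T}" by force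
  then show ?thesis by (simp add: card_image inj_on_def)
qed

text \<open>Comb positions determine the tiling, and \<open>N - Max Q\<close> is the last cell where
  a comb can start; if \<open>N \<le> Max Q\<close>, only the empty set of positions is
  left.\<close>

lemma card_comb_tilings:
  assumes "finite Q" "\<forall>j\<in>Q. j > 0" "Q \<noteq> {}"
  shows "card (comb_tilings Q N k) =
    card (avoiding (int ` Q) 1 (int N - int (Max Q)) (int k))"
proof -
  define f where "f T = int ` {c. (c, Comb) \<in> T}" for T :: "(nat \<times> tile) set"
  have tiling: "T = tiling_of Q N {c. (c, Comb) \<in> T}" if "T \<in> comb_tilings Q N k" for T
    using that tiling_eq_tiling_of unfolding comb_tilings_def by blast
  have "inj_on f (comb_tilings Q N k)"
  proof (rule inj_onI)
    fix T T' assume T: "T \<in> comb_tilings Q N k" "T' \<in> comb_tilings Q N k" and "f T = f T'"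
    then have "{c. (c, Comb) \<in> T} = {c. (c, Comb) \<in> T'}"
      by (simp add: f_def inj_image_eq_iff)
    then show "T = T'" using tiling[OF T(1)] tiling[OF T(2)] by simp
  qed
  moreover have "f ` comb_tilings Q N k = avoiding (int ` Q) 1 (int N - int (Max Q)) (int k)"
    (is "?L = ?R")
  proof (intro equalityI subsetI)
    fix S' assume "S' \<in> ?L"
    then obtain T where T: "T \<in> comb_tilings Q N k" "S' = f T" by blast
    define S where "S = {c. (c, Comb) \<in> T}"
    have "restricted_overlap_tiling Q N (tiling_of Q N S)"
      using T(1) tiling[OF T(1)] unfolding S_def by (simp add: comb_tilings_def)
    then have *: "\<forall>c\<in>S. 1 \<le> c \<and> c + Max Q \<le> N" "\<forall>s\<in>S. \<forall>t\<in>S. \<forall>j\<in>Q. t \<noteq> s + j"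
      unfolding tiling_of_iff[OF assms] by simp_all
    have "card S = k" using T(1) unfolding S_def comb_tilings_def card_combs by simp
    moreover have "S' = int ` S" by (simp add: T(2) f_def S_def)
    moreover have "int c \<in> {1..int N - int (Max Q)}" if "c \<in> S" for c
      using *(1) that by force
    moreover have "int t - int s \<notin> int ` Q" if "s \<in> S" "t \<in> S" for s t
    proof
      assume "int t - int s \<in> int ` Q"
      then obtain j where j: "j \<in> Q" "int t - int s = int j" by blast
      then have "t = s + j" by linarith
      then show False using *(2) that j(1) by blast
    qed
    ultimately show "S' \<in> ?R" by (auto simp: avoiding_def card_image)
  next
    fix S' assume S': "S' \<in> ?R"
    define S where "S = nat ` S'"
    have S'_eq: "S' = int ` S"
    proof -
      have "int (nat s) = s" if "s \<in> S'" for s using S' that by (auto simp: avoiding_def)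
      then show ?thesis by (simp add: S_def image_image)
    qed
    have "card S' = card S" by (simp add: S'_eq card_image)
    then have "card S = k" using S' by (simp add: avoiding_def)
    moreover have "\<forall>c\<in>S. 1 \<le> c \<and> c + Max Q \<le> N"
      using S' by (force simp: avoiding_def S'_eq)
    moreover have "\<forall>s\<in>S. \<forall>t\<in>S. \<forall>j\<in>Q. t \<noteq> s + j"
    proof (intro ballI notI)
      fix s t j assume "s \<in> S" "t \<in> S" "j \<in> Q" "t = s + j"
      moreover from this have "int t - int s = int j" by simp
      ultimately show False using S' unfolding avoiding_def S'_eq by blast
    qed
    ultimately have "tiling_of Q N S \<in> comb_tilings Q N k"
      using tiling_of_iff[OF assms] by (simp add: comb_tilings_def card_combs combs_of_tiling_of)
    moreover have "f (tiling_of Q N S) = S'" by (simp add: f_def combs_of_tiling_of S'_eq)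
    ultimately show "S' \<in> ?L" by blast
  qed
  ultimately show ?thesis by (metis card_image)
qed

text \<open>A window of \<open>u - l + 1\<close> comb positions belongs to a board longer by
  \<open>Max Q\<close>. The case split arises because an empty window still admits the empty set
  when \<open>k = 0\<close>, whereas \<open>B\<close> vanishes at negative length.\<close>

lemma B_eq_card_avoiding:
  assumes "finite Q" "\<forall>j\<in>Q. j > 0" "Q \<noteq> {}"
  shows "B Q (u - l + 1 + int (Max Q)) k =
    (if u - l + 1 + int (Max Q) < 0 then 0 else int (card (avoiding (int ` Q) l u k)))"
proof (cases "u - l + 1 + int (Max Q) < 0 \<or> k < 0")
  case True
  then show ?thesis by (auto simp: B_def avoiding_def)
next
  case False
  have "card (avoiding (int ` Q) 1 (u - l + 1) k) = card (avoiding (int ` Q) l u k)"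
    using avoiding_shift[of "int ` Q" 1 "l - 1" "u - l + 1" k] by simp
  then show ?thesis
    using False card_comb_tilings[OF assms, of "nat (u - l + 1 + int (Max Q))" "nat k"]
    by (simp add: B_def)
qed

section \<open>Gaps and the structure of avoiding sets\<close>

text \<open>
  \<open>R\<close> and \<open>h\<close> are the differences \<open>p\<^sub>1, \<dots>, p\<^sub>a\<^sub>-\<^sub>1\<close> and \<open>p\<^sub>a\<close>.
\<close>

locale comb_gaps =
  fixes Q :: "nat set" and q h :: int and R :: "int set"
  assumes finite_Q: "finite Q" and Q_nonempty: "Q \<noteq> {}" and Q_pos: "\<forall>j\<in>Q. j > 0"
    and q_eq: "q = int (Max Q)"
    and gaps: "{1..q} - int ` Q = insert h R" and h_notin: "h \<notin> R"
    and gap_sum: "\<And>x y. x \<in> R \<Longrightarrow> y \<in> insert h R \<Longrightarrow> x + y \<in> int ` Q"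
    and two_h: "2 * h > q"
begin

abbreviation "V \<equiv> avoiding (int ` Q)"

abbreviation "C l u k \<equiv> {S \<in> V l u k. l \<in> S}"

text \<open>Excluding every \<open>l + x\<close> amounts to excluding first differences in
  \<open>R\<close>: if \<open>l + x\<close> is in \<open>S\<close>, nothing lies strictly between,
  as the proof of \<open>card_gap_in_R\<close> shows.\<close>

abbreviation "D l u k \<equiv> {S \<in> V l u k. l \<in> S \<and> (\<forall>x\<in>R. l + x \<notin> S)}"

lemma Q_range: "x \<in> int ` Q \<Longrightarrow> 1 \<le> x \<and> x \<le> q"
  using Q_pos Max_ge[OF finite_Q] by (auto simp: q_eq Suc_le_eq)

lemma gap_range: "x \<in> insert h R \<Longrightarrow> 1 \<le> x \<and> x \<le> q \<and> x \<notin> int ` Q"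
  unfolding gaps[symmetric] by simp

lemma q_nonneg: "q \<ge> 0"
  by (simp add: q_eq)

lemma finite_R: "finite R"
  using gap_range by (intro finite_subset[of R "{1..q}"]) auto

lemma B_V: "B Q (u - l + 1 + q) k = (if u - l + 1 + q < 0 then 0 else int (card (V l u k)))"
  using B_eq_card_avoiding[OF finite_Q Q_pos Q_nonempty] by (simp add: q_eq)

lemma V_dest:
  assumes "S \<in> V l u k" "s \<in> S" "t \<in> S"
  shows "l \<le> s" "s \<le> u" "t - s \<notin> int ` Q"
proof -
  have "s \<in> {l..u}" using assms by (auto simp: avoiding_def)
  then show "l \<le> s" "s \<le> u" by simp_all
  show "t - s \<notin> int ` Q" using assms unfolding avoiding_def by blast
qed

lemma V_dist:
  assumes "S \<in> V l u k" "s \<in> S" "t \<in> S" "s < t"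
  shows "t - s \<in> insert h R \<or> t - s > q"
proof (rule disjCI)
  assume "\<not> t - s > q"
  then have "t - s \<in> {1..q} - int ` Q" using V_dest(3)[OF assms(1-3)] assms(4) by simp
  then show "t - s \<in> insert h R" unfolding gaps .
qed

text \<open>Prepends \<open>X\<close> to \<open>S\<close>: as \<open>X\<close> lies to the left,
  differences from \<open>S\<close> back to \<open>X\<close> are negative and cannot be in
  \<open>Q\<close>. \<open>V_diff\<close> is the reverse operation.\<close>

lemma V_union:
  assumes "S \<in> V m u k" "finite X" "X \<subseteq> {l..u}" "l \<le> m" "X \<inter> S = {}"
    and "\<And>x y. x \<in> X \<Longrightarrow> y \<in> X \<Longrightarrow> y - x \<notin> int ` Q"
    and "\<And>x s. x \<in> X \<Longrightarrow> s \<in> S \<Longrightarrow> x < s \<and> s - x \<notin> int ` Q"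
  shows "X \<union> S \<in> V l u (k + int (card X))"
proof -
  have card: "card (X \<union> S) = card X + card S"
    by (rule card_Un_disjoint[OF assms(2) finite_avoiding_mem[OF assms(1)] assms(5)])
  have *: "x - s \<notin> int ` Q" if "x \<in> X" "s \<in> S" for x s
    using assms(7)[OF that] Q_range[of "x - s"] by linarith
  have subset: "X \<union> S \<subseteq> {l..u}"
    using assms(1,3,4) by (auto simp: avoiding_def)
  have "t - s \<notin> int ` Q" if "s \<in> X \<union> S" "t \<in> X \<union> S" for s t
    using that *[of t s] assms(6)[of s t] assms(7)[of s t] V_dest(3)[OF assms(1), of s t] by auto
  moreover have "int (card S) = k" using assms(1) by (simp add: avoiding_def)
  ultimately show ?thesis using card subset by (simp add: avoiding_def)
qed

lemma V_diff:
  assumes "S \<in> V l u k" "X \<subseteq> S" "\<And>s. s \<in> S - X \<Longrightarrow> m \<le> s"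
  shows "S - X \<in> V m u (k - int (card X))"
proof -
  have "finite S" using assms(1) by (rule finite_avoiding_mem)
  moreover from this have "finite X" using assms(2) finite_subset by blast
  ultimately have "card (S - X) = card S - card X" "card X \<le> card S"
    using assms(2) by (simp_all add: card_Diff_subset card_mono)
  then have "int (card (S - X)) = k - int (card X)"
    using assms(1) by (auto simp: avoiding_def)
  then show ?thesis using V_dest[OF assms(1)] assms(3) by (auto simp: avoiding_def)
qed

section \<open>Recurrences for \<open>B\<close>, \<open>C\<close> and \<open>D\<close>\<close>

text \<open>Split by whether \<open>l\<close> is in the set. The delta accounts for length 0, where
  the empty tiling counts once but \<open>B\<close> at length -1 is 0.\<close>

lemma B_rec_C: "B Q (u - l + 1 + q) k =
    of_bool (u - l + 1 + q = 0) * of_bool (k = 0) + B Q (u - l + q) k + int (card (C l u k))"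
proof -
  have V_split: "card (V l u k) = card (V (l + 1) u k) + card (C l u k)"
  proof -
    have "V l u k = V (l + 1) u k \<union> C l u k"
    proof (intro equalityI subsetI)
      fix S assume S: "S \<in> V l u k"
      have "s \<noteq> l \<Longrightarrow> s \<in> S \<Longrightarrow> l + 1 \<le> s" for s using V_dest(1)[OF S] by fastforce
      then show "S \<in> V (l + 1) u k \<union> C l u k"
        using S by (fastforce simp: avoiding_def)
    qed (auto simp: avoiding_def)
    moreover have "V (l + 1) u k \<inter> C l u k = {}" by (auto simp: avoiding_def)
    ultimately show ?thesis by (metis (no_types, lifting) card_Un_disjoint finite_Un finite_avoiding)
  qed
  have C_empty: "C l u k = {}" if "u < l" using that by (auto simp: avoiding_def)
  have V_empty: "V l u k = (if k = 0 then {{}} else {})" if "u < l"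
    using that by (auto simp: avoiding_def)
  show ?thesis
  proof (cases "u - l + 1 + q \<le> 0")
    case True
    then have "u < l" using q_nonneg by linarith
    then show ?thesis
      using True C_empty V_empty B_V[of u l k] B_V[of u "l + 1" k] by (auto simp: algebra_simps)
  next
    case False
    then show ?thesis
      using V_split B_V[of u l k] B_V[of u "l + 1" k] by (simp add: algebra_simps)
  qed
qed

text \<open>A difference in \<open>R\<close> isolates its pair: no other element lies between
  \<open>l\<close> and \<open>l + x\<close> or within \<open>q\<close> beyond \<open>l + x\<close>.
  The rest is an arbitrary avoiding set from \<open>l + x + q + 1\<close> on, which corresponds to a
  board of length \<open>u - l - x\<close>.\<close>

lemma card_gap_in_R:
  assumes "x \<in> R"
  shows "int (card {S \<in> V l u k. l \<in> S \<and> l + x \<in> S}) = B Q (u - l - x) (k - 2)"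
    (is "int (card ?E) = _")
proof (cases "l + x \<le> u")
  case True
  have x: "1 \<le> x" "x \<le> q" "x \<notin> int ` Q" using gap_range assms by auto
  have card2: "int (card {l, l + x}) = 2" using x by auto
  have "?E = (\<union>) {l, l + x} ` V (l + x + q + 1) u (k - 2)" (is "_ = ?I")
  proof (intro equalityI subsetI)
    fix S assume "S \<in> ?E"
    then have S: "S \<in> V l u k" "l \<in> S" "l + x \<in> S" by auto
    have "l + x + q + 1 \<le> s" if s: "s \<in> S - {l, l + x}" for s
    proof -
      from s have sS: "s \<in> S" and ne: "s \<noteq> l" "s \<noteq> l + x" by auto
      have "l < s" using V_dest(1)[OF S(1) sS sS] ne by simp
      consider "s < l + x" | "l + x < s" using ne by linarith
      then show ?thesis
      proof cases
        case 1
        then have "s - l \<in> insert h R"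
          using V_dist[OF S(1,2) sS \<open>l < s\<close>] x by auto
        moreover have "l + x - s \<in> insert h R"
          using V_dist[OF S(1) sS S(3) 1] x \<open>l < s\<close> by auto
        \<comment> \<open>Two copies of \<open>h\<close> exceed \<open>q \<ge> x\<close>, so one
          part lies in \<open>R\<close>, and \<open>gap_sum\<close> puts the total \<open>x\<close>
          into \<open>Q\<close>, a contradiction.\<close>
        moreover have "s - l \<noteq> h \<or> l + x - s \<noteq> h" using two_h x by auto
        ultimately have "(s - l) + (l + x - s) \<in> int ` Q"
          using gap_sum[of "s - l" "l + x - s"] gap_sum[of "l + x - s" "s - l"]
          by (auto simp: algebra_simps)
        then show ?thesis using x by simp
      next
        case 2
        have "s - (l + x) \<notin> insert h R"
          using gap_sum[OF assms, of "s - (l + x)"] V_dest(3)[OF S(1,2) sS] by auto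
        then show ?thesis using V_dist[OF S(1,3) sS 2] by auto
      qed
    qed
    from V_diff[OF S(1) _ this] S card2
    have "S - {l, l + x} \<in> V (l + x + q + 1) u (k - 2)" by (metis empty_subsetI insert_subset)
    moreover have "S = {l, l + x} \<union> (S - {l, l + x})" using S by blast
    ultimately show "S \<in> ?I" by blast
  next
    fix S assume "S \<in> ?I"
    then obtain S' where S': "S' \<in> V (l + x + q + 1) u (k - 2)" "S = {l, l + x} \<union> S'" by blast
    have far: "l + x + q + 1 \<le> s" if "s \<in> S'" for s using V_dest(1)[OF S'(1) that that] .
    have "{l, l + x} \<union> S' \<in> V l u (k - 2 + int (card {l, l + x}))"
    proof (rule V_union[OF S'(1)])
      fix y s assume "y \<in> {l, l + x}" "s \<in> S'"
      then show "y < s \<and> s - y \<notin> int ` Q"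
        using far[of s] Q_range[of "s - y"] x by fastforce
    next
      fix y z assume "y \<in> {l, l + x}" "z \<in> {l, l + x}"
      then show "z - y \<notin> int ` Q" using x Q_range[of "z - y"] by fastforce
    qed (use far x True in fastforce)+
    then show "S \<in> ?E" using S' card2 by auto
  qed
  moreover have "card ?I = card (V (l + x + q + 1) u (k - 2))"
    by (rule card_union_image) (use x in \<open>auto simp: avoiding_def\<close>)
  ultimately show ?thesis
    using True B_V[of u "l + x + q + 1" "k - 2"] by (simp add: algebra_simps)
next
  case False
  then have "?E = {}" by (auto simp: avoiding_def)
  then show ?thesis using False by (simp add: B_def)
qed

text \<open>At most one \<open>x\<close> in \<open>R\<close> has \<open>l + x\<close> in the set:
  for two such \<open>x < y\<close>, the difference \<open>y - x\<close> is a gap, so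
  \<open>gap_sum\<close> would put \<open>y\<close> into \<open>Q\<close>.\<close>

lemma C_split: "int (card (C l u k)) = int (card (D l u k)) + (\<Sum>x\<in>R. B Q (u - l - x) (k - 2))"
proof -
  define E where "E x = {S \<in> V l u k. l \<in> S \<and> l + x \<in> S}" for x
  have fin: "finite (E x)" for x by (simp add: E_def)
  have no_two: False if "S \<in> V l u k" "l + x \<in> S" "l + y \<in> S" "x \<in> R" "y \<in> R" "x < y" for S x y
  proof -
    have "y - x \<in> insert h R"
      using V_dist[OF that(1-3)] that gap_range[of x] gap_range[of y] by auto
    then have "x + (y - x) \<in> int ` Q" using gap_sum that by blast
    then show False using gap_range[of y] that by simp
  qed
  have disj: "E x \<inter> E y = {}" if "x \<in> R" "y \<in> R" "x \<noteq> y" for x y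
    using no_two[of _ x y] no_two[of _ y x] that by (fastforce simp: E_def)
  have "C l u k = D l u k \<union> (\<Union>x\<in>R. E x)" by (auto simp: E_def)
  moreover have "D l u k \<inter> (\<Union>x\<in>R. E x) = {}" by (auto simp: E_def)
  ultimately have "card (C l u k) = card (D l u k) + card (\<Union>x\<in>R. E x)"
    using fin finite_R by (simp add: card_Un_disjoint)
  also have "card (\<Union>x\<in>R. E x) = (\<Sum>x\<in>R. card (E x))"
    using disj fin finite_R by (intro card_UN_disjoint) auto
  finally show ?thesis using card_gap_in_R by (simp add: E_def)
qed

text \<open>The element after \<open>l\<close> is \<open>l + h\<close> or lies beyond
  \<open>l + q\<close>. In the first case the rest is again a \<open>D\<close>-set, now starting at
  \<open>l + h\<close>; conversely \<open>l\<close> may be prepended to any such set, which is why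
  runs of \<open>h\<close> are unrestricted.\<close>

lemma D_rec: "int (card (D l u k)) = B Q (u - l) (k - 1) + int (card (D (l + h) u (k - 1)))"
proof (cases "l \<le> u")
  case True
  have h: "1 \<le> h" "h \<le> q" "h \<notin> int ` Q" using gap_range by auto
  have R: "1 \<le> x \<and> x \<le> q \<and> x \<noteq> h" if "x \<in> R" for x using gap_range that h_notin by auto
  have second: "s = l + h \<or> l + q + 1 \<le> s" if "S \<in> D l u k" "s \<in> S" "s \<noteq> l" for S s
  proof -
    have "l < s" using V_dest(1)[of S l u k s s] that by fastforce
    moreover have "s - l \<notin> R" using that by (auto dest: bspec[of _ _ "s - l"])
    ultimately show ?thesis using V_dist[of S l u k l s] that by auto
  qed
  have D_split: "D l u k = (\<union>) {l} ` V (l + q + 1) u (k - 1) \<union> (\<union>) {l} ` D (l + h) u (k - 1)"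
    (is "_ = ?I \<union> ?J")
  proof (intro equalityI subsetI)
    fix S assume SD: "S \<in> D l u k"
    then have S: "S \<in> V l u k" "l \<in> S" by auto
    have eq: "S = {l} \<union> (S - {l})" using S by blast
    show "S \<in> ?I \<union> ?J"
    proof (cases "l + h \<in> S")
      case True
      have *: "l + h \<le> s" if "s \<in> S - {l}" for s
        using second[OF SD, of s] that h by auto
      have "S - {l} \<in> V (l + h) u (k - 1)"
        using V_diff[OF S(1) _ *, of "{l}"] S(2) by simp
      \<comment> \<open>Here \<open>l\<close> itself excludes \<open>l + h + x\<close>, because
        \<open>x + h\<close> is in \<open>Q\<close>.\<close>
      moreover have "l + h + x \<notin> S" if "x \<in> R" for x
      proof
        assume "l + h + x \<in> S"
        moreover have "x + h \<in> int ` Q" using gap_sum[OF that] by simp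
        moreover have "l + h + x - l = x + h" by simp
        ultimately show False using V_dest(3)[OF S, of "l + h + x"] by metis
      qed
      ultimately have "S - {l} \<in> D (l + h) u (k - 1)" using True h by auto
      then show ?thesis using eq by blast
    next
      case False
      have *: "l + q + 1 \<le> s" if "s \<in> S - {l}" for s
        using second[OF SD, of s] that False by auto
      have "S - {l} \<in> V (l + q + 1) u (k - 1)"
        using V_diff[OF S(1) _ *, of "{l}"] S(2) by simp
      then show ?thesis using eq by blast
    qed
  next
    fix S assume "S \<in> ?I \<union> ?J"
    then consider S' where "S' \<in> V (l + q + 1) u (k - 1)" "S = {l} \<union> S'"
      | S' where "S' \<in> D (l + h) u (k - 1)" "S = {l} \<union> S'" by blast
    then show "S \<in> D l u k"
    proof cases
      case (1 S')
      have far: "l + q + 1 \<le> s" if "s \<in> S'" for s using V_dest(1)[OF 1(1) that that] .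
      have "{l} \<union> S' \<in> V l u (k - 1 + int (card {l}))"
        using far Q_range q_nonneg True by (intro V_union[OF 1(1)]) fastforce+
      moreover have "l + x \<notin> S" if "x \<in> R" for x
        using R[OF that] far[of "l + x"] 1(2) by auto
      ultimately show ?thesis using 1(2) by auto
    next
      case (2 S')
      have S': "S' \<in> V (l + h) u (k - 1)" "l + h \<in> S'" "\<forall>x\<in>R. l + h + x \<notin> S'"
        using 2(1) by auto
      \<comment> \<open>Every later element is at distance \<open>h\<close> or more than
        \<open>q\<close> from \<open>l + h\<close>; as \<open>2 * h > q\<close>, both put it beyond
        \<open>l + q\<close>.\<close>
      have far: "s = l + h \<or> l + q < s" if "s \<in> S'" for s
      proof (cases "s = l + h")
        case False
        then have "l + h < s" using V_dest(1)[OF S'(1) that that] by simp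
        moreover have "s - (l + h) \<notin> R" using S'(3) that by (auto dest: bspec[of _ _ "s - (l + h)"])
        ultimately show ?thesis using V_dist[OF S'(1,2) that] two_h h by auto
      qed simp
      have "{l} \<union> S' \<in> V l u (k - 1 + int (card {l}))"
      proof (rule V_union[OF S'(1)])
        fix x s assume "x \<in> {l}" "s \<in> S'"
        then show "x < s \<and> s - x \<notin> int ` Q" using far[of s] Q_range[of "s - x"] h by auto
      next
        fix x y assume "x \<in> {l}" "y \<in> {l}"
        then show "y - x \<notin> int ` Q" using Q_range[of 0] by auto
      qed (use far h q_nonneg True in fastforce)+
      moreover have "l + x \<notin> S" if "x \<in> R" for x
        using R[OF that] far[of "l + x"] 2(2) by auto
      ultimately show ?thesis using 2(2) by auto
    qed
  qed
  \<comment> \<open>Membership of \<open>l + h\<close> separates the two families, since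
    \<open>h \<le> q\<close>.\<close>
  have "l + h \<notin> S" if "S \<in> ?I" for S
    using that h by (auto simp: avoiding_def)
  then have "?I \<inter> ?J = {}" by blast
  then have "card (D l u k) = card ?I + card ?J"
    unfolding D_split by (intro card_Un_disjoint) simp_all
  moreover have "card ?I = card (V (l + q + 1) u (k - 1))"
    by (rule card_union_image) (use q_nonneg in \<open>auto simp: avoiding_def\<close>)
  moreover have "card ?J = card (D (l + h) u (k - 1))"
    by (rule card_union_image) (use h in \<open>auto simp: avoiding_def\<close>)
  ultimately show ?thesis
    using True B_V[of u "l + q + 1" "k - 1"] by simp
next
  case False
  moreover have "h \<ge> 1" using gap_range by blast
  ultimately have "D l u k = {}" "D (l + h) u (k - 1) = {}" by (auto simp: avoiding_def)
  then show ?thesis unfolding \<open>D l u k = {}\<close> \<open>D (l + h) u (k - 1) = {}\<close>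
    using False by (simp add: B_def)
qed

section \<open>Elimination of \<open>C\<close> and \<open>D\<close>\<close>

theorem B_recurrence:
  "B Q n k = of_bool (n = 0) * of_bool (k = 0) - of_bool (n = h) * of_bool (k = 1)
     + B Q (n - 1) k + B Q (n - h) (k - 1) - B Q (n - h - 1) (k - 1) + B Q (n - q - 1) (k - 1)
     + (\<Sum>x\<in>R. B Q (n - q - 1 - x) (k - 2) - B Q (n - h - q - 1 - x) (k - 3))"
proof -
  \<comment> \<open>The last cell where a comb can start on an \<open>n\<close>-board.\<close>
  define u where "u = n - q"
  have "B Q n k = of_bool (n = 0) * of_bool (k = 0) + B Q (n - 1) k + int (card (C 1 u k))"
    using B_rec_C[of u 1 k] by (simp add: u_def)
  \<comment> \<open>The same recurrence moved by \<open>h\<close> with one comb fewer; its delta is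
    the source of the correction at \<open>n = h\<close>, \<open>k = 1\<close>.\<close>
  moreover have "B Q (n - h) (k - 1) = of_bool (n = h) * of_bool (k = 1)
      + B Q (n - h - 1) (k - 1) + int (card (C (1 + h) u (k - 1)))"
    using B_rec_C[of u "1 + h" "k - 1"] by (simp add: u_def algebra_simps)
  moreover have "int (card (C 1 u k)) = int (card (D 1 u k)) + (\<Sum>x\<in>R. B Q (n - q - 1 - x) (k - 2))"
    using C_split[of 1 u k] by (simp add: u_def)
  moreover have "int (card (C (1 + h) u (k - 1))) = int (card (D (1 + h) u (k - 1)))
      + (\<Sum>x\<in>R. B Q (n - h - q - 1 - x) (k - 3))"
    using C_split[of "1 + h" u "k - 1"] by (simp add: u_def algebra_simps)
  moreover have "int (card (D 1 u k)) = B Q (n - q - 1) (k - 1) + int (card (D (1 + h) u (k - 1)))"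
    using D_rec[of 1 u k] by (simp add: u_def)
  ultimately show ?thesis by (simp add: sum_subtractf)
qed

end

section \<open>From bit strings to the gap conditions\<close>

text \<open>The bit of \<open>Max Q\<close> is set, so being all ones forces a one at every lower
  position. At a gap \<open>y\<close> the unshifted string has a zero, so the one comes from the
  shifted string, whose bit there is that of \<open>x + y\<close>.\<close>

lemma all_ones_bit_string_gap_sum:
  assumes "finite Q" "\<forall>j\<in>Q. j > 0" "Q \<noteq> {}"
    and "all_ones (or (bit_string Q) (drop_bit x (bit_string Q)))"
    and "y \<in> {1..Max Q} - Q"
  shows "x + y \<in> Q"
proof -
  have bit: "bit (bit_string Q) (j - 1) \<longleftrightarrow> j \<in> Q" if "j \<ge> 1" for j
    using bit_bit_string assms(1,2) that by blast
  obtain m where m: "or (bit_string Q) (drop_bit x (bit_string Q)) = mask m"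
    using assms(4) by (auto simp: all_ones_def)
  have "bit (mask m :: nat) (j - 1) \<longleftrightarrow> j \<in> Q \<or> x + j \<in> Q" if "j \<ge> 1" for j
    using bit[OF that] bit[of "x + j"] that
    by (simp flip: m add: bit_or_iff bit_drop_bit_eq)
  then have mask: "j - 1 < m \<longleftrightarrow> j \<in> Q \<or> x + j \<in> Q" if "j \<ge> 1" for j
    using that by (simp add: bit_mask_iff)
  have "Max Q \<in> Q" using assms by simp
  then have "Max Q - 1 < m" using mask[of "Max Q"] assms(2) by auto
  then show ?thesis using mask[of y] assms(5) by auto
qed

theorem theorem6:
  fixes Q :: "nat set" and q a r :: nat and p :: "nat \<Rightarrow> nat" and \<theta> :: nat and n k :: int
  assumes "finite Q" and "Q \<noteq> {}" and "\<forall>j\<in>Q. j > 0"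
    and "q = Max Q"
    and "a = card ({1..q} - Q)"
    and "strict_mono_on {1..a} p" and "p ` {1..a} = {1..q} - Q"
    and "\<theta> = bit_string Q"
    and "a \<ge> 2"
    and "int (p a) = int q - int r"
    and "\<forall>i\<in>{1..a-1}. all_ones (or \<theta> (drop_bit (p i) \<theta>))"
    and "q = 2 * r + 1 \<or> q > 2 * r + 1 \<and> 1 \<le> p (a - 1) \<and> p (a - 1) \<le> r"
  shows "B Q n k =
      of_bool (n = 0) * of_bool (k = 0) - of_bool (n = int q - int r) * of_bool (k = 1)
      + B Q (n - 1) k + B Q (n - int q + int r) (k - 1)
      - B Q (n - int q + int r - 1) (k - 1) + B Q (n - int q - 1) (k - 1)
      + (\<Sum>i = 1..a-1. B Q (n - int q - 1 - int (p i)) (k - 2)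
            - B Q (n - 2 * int q + int r - 1 - int (p i)) (k - 3))"
proof -
  define R where "R = (\<lambda>i. int (p i)) ` {1..a-1}"
  have inj: "inj_on p {1..a}" using assms(6) by (rule strict_mono_on_imp_inj_on)
  have range_a: "{1..a} = insert a {1..a-1}" using assms(9) by auto
  have p_gaps: "{1..q} - Q = insert (p a) (p ` {1..a-1})"
    using assms(7) range_a by (metis image_insert)
  interpret comb_gaps Q "int q" "int (p a)" R
  proof
    show "{1..int q} - int ` Q = insert (int (p a)) R"
    proof -
      have "{1..int q} = int ` {1..q}" using image_int_atLeastAtMost[of 1 q] by simp
      then have "{1..int q} - int ` Q = int ` ({1..q} - Q)" by (simp add: image_set_diff)
      then show ?thesis unfolding p_gaps R_def image_insert image_image .
    qed
    show "int (p a) \<notin> R"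
    proof
      assume "int (p a) \<in> R"
      then obtain i where i: "i \<in> {1..a-1}" "p i = p a" by (auto simp: R_def)
      then have "i \<in> {1..a}" "a \<in> {1..a}" "i \<noteq> a" using assms(9) by auto
      then show False using inj_onD[OF inj i(2)] by blast
    qed
    show "x + y \<in> int ` Q" if "x \<in> R" "y \<in> insert (int (p a)) R" for x y
    proof -
      from that(1) obtain i where i: "i \<in> {1..a-1}" "x = int (p i)" by (auto simp: R_def)
      from that(2) have "y \<in> int ` ({1..q} - Q)" unfolding p_gaps R_def by auto
      then obtain y' where y': "y' \<in> {1..q} - Q" "y = int y'" by blast
      have "p i + y' \<in> Q"
        using all_ones_bit_string_gap_sum[OF assms(1,3,2)] assms(4,8,11) i y' by blast
      then show ?thesis using i y' by (metis image_eqI of_nat_add)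
    qed
    \<comment> \<open>Both cases give \<open>q > 2 * r\<close>, while
      \<open>p a = q - r\<close>.\<close>
    show "int q < 2 * int (p a)" using assms(10,12) by auto
  qed (use assms in auto)
  have "inj_on (\<lambda>i. int (p i)) {1..a-1}"
    using inj range_a by (auto simp: inj_on_def)
  then have "(\<Sum>x\<in>R. f x) = (\<Sum>i = 1..a-1. f (int (p i)))" for f :: "int \<Rightarrow> int"
    by (simp add: R_def sum.reindex)
  then show ?thesis
    using B_recurrence[of n k] assms(10) by (simp add: algebra_simps)
qed

end
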